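(* Suppose $E_c^{\min}=E_d^{\min}=0$. Let $\mathbf p$ be (the $\mathbf p$-component of) an optimal solution to the regularized problem (Reg-Battery) with parameter $\boldsymbol\lambda=(\lambda_c,\lambda_d)^\top\in\mathbb R_+^2$. Then: (i) For all $\boldsymbol\lambda\in\mathbb R_+^2$, we have $p^c_{t,i}\,p^{ls}_{t,i}=0$ for all $t\in\mathcal T$, $i\in\mathcal N$. (ii) If $\lambda_c+\eta_c\eta_d\lambda_d>1-\eta_c\eta_d$, then we have $p^d_{t,i}\,p^{ex}_{t,i}=0$ for all $t\in\mathcal T$, $i\in\mathcal N$.
   Context: Data. $\mathcal N$ is a finite set of buses, $\mathcal L\subseteq\mathcal N\times\mathcal N$ a finite set of transmission lines, $\mathcal N_b\subseteq\mathcal N$ the set of buses carrying a battery, $\mathcal T=\{1,\dots,T\}$ the time periods, $N=|\mathcal N|$. For $i\in\mathcal N$, $\delta_i^+=\{j:(i,j)\in\mathcal L\}$ and $\delta_i^-=\{j:(j,i)\in\mathcal L\}$. Real parameters: $0\le G_i^{\min}\le G_i^{\max}$ ($i\in\mathcal N$), $F_{ij}\ge0$ and $B_{ij}$ ($(i,j)\in\mathcal L$), demands $D_{t,i}$, $0\le E^{\min}\le E^{\max}$, $0\le E_c^{\min}\le E_c^{\max}$, $0\le E_d^{\min}\le E_d^{\max}$, initial state-of-charge $E_0$, and charging and discharging efficiencies $\eta_c,\eta_d\in(0,1]$. Variables (indexed by $t\in\mathcal T$): phase angles $\theta_{t,i}$, flows $f_{t,ij}$, $\mathbf p=(\mathbf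 p^g,\mathbf p^s,\mathbf p^c,\mathbf p^d,\mathbf p^{ls},\mathbf p^{ex})$ (generation, state-of-charge, charging, discharging, load shedding, excess power; $p^s$ also has components $p^s_{0,i}$), and $u_{t,i}$. Operational constraints: - $G_i^{\min}\le p^g_{t,i}\le G_i^{\max}$ for all $t\in\mathcal T,i\in\mathcal N$; - $-F_{ij}\le f_{t,ij}\le F_{ij}$ and $f_{t,ij}=B_{ij}(\theta_{t,i}-\theta_{t,j})$ for all $t\in\mathcal T,(i,j)\in\mathcal L$; - for $t\in\mathcal T,i\in\mathcal N_b$: $E_c^{\min}u_{t,i}\le p^c_{t,i}\le E_c^{\max}u_{t,i}$; $E_d^{\min}(1-u_{t,i})\le p^d_{t,i}\le E_d^{\max}(1-u_{t,i})$; $p^s_{t,i}=p^s_{t-1,i}+\eta_c p^c_{t,i}-\frac1{\eta_d}p^d_{t,i}$; $p^s_{0,i}=E_0$; $E^{\min}\le p^s_{t,i}\le E^{\max}$; - for $t\in\mathcal T,i\in\mathcal N\setminus\mathcal N_b$: $p^s_{t,i}=p^s_{0,i}=p^c_{t,i}=p^d_{t,i}=u_{t,i}=0$; - $p^{ls}_{t,i}\ge0$, $p^{ex}_{t,i}\ge0$ for all $t\in\mathcal T,i\in\mathcal N$; - $\sum_{j\in\delta_i^+}f_{t,ij}-\sum_{j\in\delta_i^-}f_{t,ji}=p^g_{t,i}-D_{t,i}-p^c_{t,i}+p^d_{t,i}+p^{ls}_{t,i}-p^{ex}_{t,i}$ for all $t\in\mathcal T,i\in\mathcal N$. Objective: $c(\mathbf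 p)=c^g(\mathbf p^g)+\sum_{t\in\mathcal T}\sum_{i\in\mathcal N}(p^{ls}_{t,i}+p^{ex}_{t,i})$, where $c^g$ is a real-valued generator cost function (usually linear or convex quadratic), and $g(\mathbf p)=\left(\sum_{t\in\mathcal T}\sum_{i\in\mathcal N}p^c_{t,i},\ \sum_{t\in\mathcal T}\sum_{i\in\mathcal N}p^d_{t,i}\right)^\top$. The regularized problem (Reg-Battery) with parameter $\boldsymbol\lambda\in\mathbb R_+^2$ is to minimize $c(\mathbf p)+\boldsymbol\lambda^\top g(\mathbf p)$ over all $(\boldsymbol\theta,\mathbf f,\mathbf p,\mathbf u)$ satisfying the operational constraints and $\mathbf u\in\{0,1\}^{T\times N}$.
   Formalization: Two hypotheses are added, as the claim fails without them: the initial state-of-charge satisfies E^min ≤ E_0 ≤ E^max, and the lossless unregularized case (λ_c = λ_d = 0 together with η_c = η_d = 1) is excluded. *)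

theory Defs
  imports "HOL-Analysis.Analysis"
begin

record 'b battery_data =
  buses :: "'b set"
  lines :: "('b \<times> 'b) set"
  battery_buses :: "'b set"
  horizon :: nat
  G_min :: "'b \<Rightarrow> real"
  G_max :: "'b \<Rightarrow> real"
  F_cap :: "'b \<Rightarrow> 'b \<Rightarrow> real"
  B_sus :: "'b \<Rightarrow> 'b \<Rightarrow> real"
  demand :: "nat \<Rightarrow> 'b \<Rightarrow> real"
  E_min :: real
  E_max :: real
  Ec_min :: real
  Ec_max :: real
  Ed_min :: real
  Ed_max :: real
  E_init :: real
  eta_c :: real
  eta_d :: real
  gen_cost :: "(nat \<Rightarrow> 'b \<Rightarrow> real) \<Rightarrow> real"

text \<open>No relation between \<open>E_init\<close> and the limits \<open>E_min\<close>, \<open>E_max\<close> is imposed by \<open>valid_data\<close>: the operational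
  constraints bound the state of charge in the periods \<open>1, ..., horizon\<close> only.\<close>

text \<open>The vector \<open>p\<close> of power variables. Components are functions of a period and a bus;
  only \<open>p_soc\<close> is ever used at period \<open>0\<close>.\<close>

record 'b power =
  p_gen :: "nat \<Rightarrow> 'b \<Rightarrow> real"
  p_soc :: "nat \<Rightarrow> 'b \<Rightarrow> real"
  p_ch :: "nat \<Rightarrow> 'b \<Rightarrow> real"
  p_dis :: "nat \<Rightarrow> 'b \<Rightarrow> real"
  p_shed :: "nat \<Rightarrow> 'b \<Rightarrow> real"
  p_exc :: "nat \<Rightarrow> 'b \<Rightarrow> real"

definition periods :: "'b battery_data \<Rightarrow> nat set" where
  "periods X = {1..horizon X}"

definition valid_data :: "'b battery_data \<Rightarrow> bool" where
  "valid_data X \<longleftrightarrow>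
     finite (buses X) \<and> lines X \<subseteq> buses X \<times> buses X \<and> battery_buses X \<subseteq> buses X \<and>
     (\<forall>i\<in>buses X. 0 \<le> G_min X i \<and> G_min X i \<le> G_max X i) \<and>
     (\<forall>(i, j)\<in>lines X. 0 \<le> F_cap X i j) \<and>
     0 \<le> E_min X \<and> E_min X \<le> E_max X \<and>
     0 \<le> Ec_min X \<and> Ec_min X \<le> Ec_max X \<and>
     0 \<le> Ed_min X \<and> Ed_min X \<le> Ed_max X \<and>
     0 < eta_c X \<and> eta_c X \<le> 1 \<and> 0 < eta_d X \<and> eta_d X \<le> 1"

definition out_nbrs :: "'b battery_data \<Rightarrow> 'b \<Rightarrow> 'b set" where
  "out_nbrs X i = {j. (i, j) \<in> lines X}"

definition in_nbrs :: "'b battery_data \<Rightarrow> 'b \<Rightarrow> 'b set" where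
  "in_nbrs X i = {j. (j, i) \<in> lines X}"

type_synonym 'b decision =
  "(nat \<Rightarrow> 'b \<Rightarrow> real) \<times> (nat \<Rightarrow> 'b \<Rightarrow> 'b \<Rightarrow> real) \<times> 'b power \<times> (nat \<Rightarrow> 'b \<Rightarrow> real)"

definition operational :: "'b battery_data \<Rightarrow> 'b decision \<Rightarrow> bool" where
  "operational X = (\<lambda>(\<theta>, f, p, u).
     (\<forall>t\<in>periods X. \<forall>i\<in>buses X. G_min X i \<le> p_gen p t i \<and> p_gen p t i \<le> G_max X i) \<and>
     (\<forall>t\<in>periods X. \<forall>(i, j)\<in>lines X.
        - F_cap X i j \<le> f t i j \<and> f t i j \<le> F_cap X i j \<and>
        f t i j = B_sus X i j * (\<theta> t i - \<theta> t j)) \<and>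
     (\<forall>t\<in>periods X. \<forall>i\<in>battery_buses X.
        Ec_min X * u t i \<le> p_ch p t i \<and> p_ch p t i \<le> Ec_max X * u t i \<and>
        Ed_min X * (1 - u t i) \<le> p_dis p t i \<and> p_dis p t i \<le> Ed_max X * (1 - u t i) \<and>
        p_soc p t i = p_soc p (t - 1) i + eta_c X * p_ch p t i - 1 / eta_d X * p_dis p t i \<and>
        p_soc p 0 i = E_init X \<and>
        E_min X \<le> p_soc p t i \<and> p_soc p t i \<le> E_max X) \<and>
     (\<forall>t\<in>periods X. \<forall>i\<in>buses X - battery_buses X.
        p_soc p t i = 0 \<and> p_soc p 0 i = 0 \<and> p_ch p t i = 0 \<and> p_dis p t i = 0 \<and> u t i = 0) \<and>
     (\<forall>t\<in>periods X. \<forall>i\<in>buses X. 0 \<le> p_shed p t i \<and> 0 \<le> p_exc p t i) \<and>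
     (\<forall>t\<in>periods X. \<forall>i\<in>buses X.
        (\<Sum>j\<in>out_nbrs X i. f t i j) - (\<Sum>j\<in>in_nbrs X i. f t j i) =
          p_gen p t i - demand X t i - p_ch p t i + p_dis p t i + p_shed p t i - p_exc p t i))"

definition reg_feasible :: "'b battery_data \<Rightarrow> 'b decision \<Rightarrow> bool" where
  "reg_feasible X = (\<lambda>(\<theta>, f, p, u).
     operational X (\<theta>, f, p, u) \<and> (\<forall>t\<in>periods X. \<forall>i\<in>buses X. u t i \<in> {0, 1}))"

text \<open>The generator cost is an arbitrary function of the family of generation levels indexed by
  periods and buses; restricting its argument makes it independent of the values of the total
  function \<open>p_gen p\<close> outside that index set.\<close>

definition cost :: "'b battery_data \<Rightarrow> 'b power \<Rightarrow> real" where
  "cost X p =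
     gen_cost X (\<lambda>t\<in>periods X. \<lambda>i\<in>buses X. p_gen p t i) +
     (\<Sum>t\<in>periods X. \<Sum>i\<in>buses X. p_shed p t i + p_exc p t i)"

definition total_ch_dis :: "'b battery_data \<Rightarrow> 'b power \<Rightarrow> real \<times> real" where
  "total_ch_dis X p =
     (\<Sum>t\<in>periods X. \<Sum>i\<in>buses X. p_ch p t i, \<Sum>t\<in>periods X. \<Sum>i\<in>buses X. p_dis p t i)"

definition reg_objective :: "'b battery_data \<Rightarrow> real \<times> real \<Rightarrow> 'b decision \<Rightarrow> real" where
  "reg_objective X lam = (\<lambda>(\<theta>, f, p, u). cost X p + lam \<bullet> total_ch_dis X p)"

definition reg_optimal :: "'b battery_data \<Rightarrow> real \<times> real \<Rightarrow> 'b decision \<Rightarrow> bool" where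
  "reg_optimal X lam x \<longleftrightarrow> is_arg_min (reg_objective X lam) (reg_feasible X) x"

end

theory Submission
  imports Defs
begin

text \<open>If a battery charges while load is shed at the same bus, lower both by the same small amount \<open>e\<close>.
  The state of charge drops, which is harmless until the first later period in which it meets its
  lower limit. In that period the battery must be discharging; lowering the discharge by
  \<open>eta_c X * eta_d X * e\<close>, at the price of shedding that much load, restores the old trajectory.
  This is a strict gain unless the battery is lossless and \<open>lam_c = lam_d = 0\<close>. For discharging with
  excess power the exchange uses the upper limit and the amount \<open>e / (eta_c X * eta_d X)\<close>, which
  pays off exactly under the condition on the regularization parameter.\<close>

text \<open>The functions \<open>a\<close>, \<open>b\<close>, \<open>x\<close>, \<open>y\<close>, \<open>w\<close> are the amounts by which charging, discharging, shedding,
  excess and state of charge at the bus \<open>i\<close> are lowered; negative values mean an increase.\<close>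

lemma reg_optimal_exchange:
  fixes X :: "'b battery_data" and a b x y w :: "nat \<Rightarrow> real"
  assumes valid: "valid_data X" and Ec: "Ec_min X = 0" and Ed: "Ed_min X = 0"
    and opt: "reg_optimal X (lc, ld) (\<theta>, f, p, u)"
    and i: "i \<in> battery_buses X"
    and a: "\<And>t. t \<in> periods X \<Longrightarrow> 0 \<le> a t \<and> a t \<le> p_ch p t i"
    and b: "\<And>t. t \<in> periods X \<Longrightarrow> 0 \<le> b t \<and> b t \<le> p_dis p t i"
    and x: "\<And>t. t \<in> periods X \<Longrightarrow> x t \<le> p_shed p t i"
    and y: "\<And>t. t \<in> periods X \<Longrightarrow> y t \<le> p_exc p t i"
    and balance: "\<And>t. t \<in> periods X \<Longrightarrow> a t - b t = x t - y t"
    and w0: "w 0 = 0"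
    and w: "\<And>t. t \<in> periods X \<Longrightarrow> w t = w (t - 1) + eta_c X * a t - b t / eta_d X"
    and soc: "\<And>t. t \<in> periods X \<Longrightarrow> E_min X \<le> p_soc p t i - w t \<and> p_soc p t i - w t \<le> E_max X"
  shows "(\<Sum>t\<in>periods X. x t + y t + lc * a t + ld * b t) \<le> 0"
proof -
  define lower :: "(nat \<Rightarrow> real) \<Rightarrow> (nat \<Rightarrow> 'b \<Rightarrow> real) \<Rightarrow> nat \<Rightarrow> 'b \<Rightarrow> real"
    where "lower h g = (\<lambda>t j. g t j - (if j = i then h t else 0))" for h g
  \<comment> \<open>The competitor keeps generation, and it will be paired with the old
    \<open>\<theta>\<close>, \<open>f\<close> and \<open>u\<close>, so generator cost, flow limits
    and integrality are unaffected.\<close>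
  define q where "q = p\<lparr>p_soc := lower w (p_soc p), p_ch := lower a (p_ch p),
    p_dis := lower b (p_dis p), p_shed := lower x (p_shed p), p_exc := lower y (p_exc p)\<rparr>"
  have q_simps: "p_gen q = p_gen p" "p_soc q = lower w (p_soc p)" "p_ch q = lower a (p_ch p)"
    "p_dis q = lower b (p_dis p)" "p_shed q = lower x (p_shed p)" "p_exc q = lower y (p_exc p)"
    by (simp_all add: q_def)
  have fin: "finite (buses X)" and iB: "i \<in> buses X"
    using valid i by (auto simp: valid_data_def)
  have lower_sum: "(\<Sum>j\<in>buses X. lower h g t j) = (\<Sum>j\<in>buses X. g t j) - h t" for h g t
    using fin iB by (simp add: lower_def sum_subtractf)
  have op: "operational X (\<theta>, f, p, u)" and bin: "\<forall>t\<in>periods X. \<forall>j\<in>buses X. u t j \<in> {0, 1}"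
    using opt by (auto simp: reg_optimal_def is_arg_min_def reg_feasible_def)
  have no_better: "reg_objective X (lc, ld) (\<theta>, f, p, u) \<le> reg_objective X (lc, ld) z"
    if "reg_feasible X z" for z
    using opt that unfolding reg_optimal_def is_arg_min_def by (meson not_less)
  have batt: "Ec_min X * u t j \<le> p_ch q t j \<and> p_ch q t j \<le> Ec_max X * u t j \<and>
        Ed_min X * (1 - u t j) \<le> p_dis q t j \<and> p_dis q t j \<le> Ed_max X * (1 - u t j) \<and>
        p_soc q t j = p_soc q (t - 1) j + eta_c X * p_ch q t j - 1 / eta_d X * p_dis q t j \<and>
        p_soc q 0 j = E_init X \<and> E_min X \<le> p_soc q t j \<and> p_soc q t j \<le> E_max X"
    if t: "t \<in> periods X" and j: "j \<in> battery_buses X" for t j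
  proof -
    have old: "Ec_min X * u t j \<le> p_ch p t j \<and> p_ch p t j \<le> Ec_max X * u t j \<and>
        Ed_min X * (1 - u t j) \<le> p_dis p t j \<and> p_dis p t j \<le> Ed_max X * (1 - u t j) \<and>
        p_soc p t j = p_soc p (t - 1) j + eta_c X * p_ch p t j - 1 / eta_d X * p_dis p t j \<and>
        p_soc p 0 j = E_init X \<and> E_min X \<le> p_soc p t j \<and> p_soc p t j \<le> E_max X"
      using op t j unfolding operational_def by blast
    show ?thesis
    proof (cases "j = i")
      case True
      \<comment> \<open>The zero lower limits \<open>Ec\<close> and \<open>Ed\<close> enter here:
        both powers can be lowered anywhere down to 0 while \<open>u\<close> is kept.\<close>
      show ?thesis
        unfolding q_simps lower_def
        using old a[OF t] b[OF t] w0 w[OF t] soc[OF t] True Ec Ed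
        by (simp add: algebra_simps diff_divide_distrib)
    qed (use old in \<open>simp add: q_simps lower_def\<close>)
  qed
  have "operational X (\<theta>, f, q, u)"
    unfolding operational_def split_conv
  proof (intro conjI)
    show "\<forall>t\<in>periods X. \<forall>j\<in>battery_buses X.
        Ec_min X * u t j \<le> p_ch q t j \<and> p_ch q t j \<le> Ec_max X * u t j \<and>
        Ed_min X * (1 - u t j) \<le> p_dis q t j \<and> p_dis q t j \<le> Ed_max X * (1 - u t j) \<and>
        p_soc q t j = p_soc q (t - 1) j + eta_c X * p_ch q t j - 1 / eta_d X * p_dis q t j \<and>
        p_soc q 0 j = E_init X \<and> E_min X \<le> p_soc q t j \<and> p_soc q t j \<le> E_max X"
      using batt by blast
    show "\<forall>t\<in>periods X. \<forall>j\<in>buses X - battery_buses X.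
        p_soc q t j = 0 \<and> p_soc q 0 j = 0 \<and> p_ch q t j = 0 \<and> p_dis q t j = 0 \<and> u t j = 0"
      using op i by (auto simp: operational_def q_simps lower_def)
    show "\<forall>t\<in>periods X. \<forall>j\<in>buses X. 0 \<le> p_shed q t j \<and> 0 \<le> p_exc q t j"
      using op x y by (auto simp: operational_def q_simps lower_def)
    show "\<forall>t\<in>periods X. \<forall>j\<in>buses X.
        (\<Sum>k\<in>out_nbrs X j. f t j k) - (\<Sum>k\<in>in_nbrs X j. f t k j) =
          p_gen q t j - demand X t j - p_ch q t j + p_dis q t j + p_shed q t j - p_exc q t j"
    proof (intro ballI)
      fix t j assume t: "t \<in> periods X" and j: "j \<in> buses X"
      then have "(\<Sum>k\<in>out_nbrs X j. f t j k) - (\<Sum>k\<in>in_nbrs X j. f t k j) =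
          p_gen p t j - demand X t j - p_ch p t j + p_dis p t j + p_shed p t j - p_exc p t j"
        using op by (auto simp: operational_def)
      \<comment> \<open>By \<open>balance\<close> the net injection at \<open>i\<close> is the same
        for \<open>q\<close> as for \<open>p\<close>, so the old flows still fit.\<close>
      then show "(\<Sum>k\<in>out_nbrs X j. f t j k) - (\<Sum>k\<in>in_nbrs X j. f t k j) =
          p_gen q t j - demand X t j - p_ch q t j + p_dis q t j + p_shed q t j - p_exc q t j"
        using balance[OF t] by (auto simp: q_simps lower_def)
    qed
  qed (use op in \<open>auto simp: operational_def q_simps\<close>)
  then have "reg_objective X (lc, ld) (\<theta>, f, p, u) \<le> reg_objective X (lc, ld) (\<theta>, f, q, u)"
    using bin by (intro no_better) (simp add: reg_feasible_def)
  \<comment> \<open>The generation costs cancel, and what remains of the difference of the two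
    objectives is exactly the claimed sum.\<close>
  then show ?thesis
    by (simp add: reg_objective_def cost_def total_ch_dis_def q_simps lower_sum sum.distrib
        sum_subtractf right_diff_distrib inner_prod_def flip: sum_distrib_left)
qed

text \<open>Take \<open>r\<close> as the first index after \<open>m\<close> that either lies beyond
  \<open>n\<close> or has \<open>v r \<le> 0\<close>. Only finitely many values precede it, all
  positive up to \<open>n\<close>, so they have a common positive lower bound. In the application
  \<open>v\<close> is the distance of the state of charge from a limit, \<open>r\<close> is the
  period of compensation and \<open>e\<close> the size of the exchange.\<close>

lemma first_exhaustion:
  fixes v :: "nat \<Rightarrow> real"
  assumes "0 < v m" and "0 < c"
  obtains r e where "m < r" "0 < e" "e \<le> c" "\<And>t. m \<le> t \<Longrightarrow> t < r \<Longrightarrow> t \<le> n \<Longrightarrow> e \<le> v t"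
    and "r \<le> n \<Longrightarrow> v r \<le> 0"
proof -
  define Q where "Q = (\<lambda>r. m < r \<and> (r \<le> n \<longrightarrow> v r \<le> 0))"
  define r where "r = (LEAST r. Q r)"
  \<comment> \<open>Intersecting with the positive reals makes \<open>e\<close> positive at once; no
    \<open>v t\<close> with \<open>t \<le> n\<close> is lost by it, since those before
    \<open>r\<close> are positive.\<close>
  define e where "e = Min (insert c (v ` {m..<r} \<inter> {0<..}))"
  have "Q (Suc (max m n))"
    by (auto simp: Q_def)
  then have r: "Q r"
    unfolding r_def by (rule LeastI)
  have "0 < v t" if "m \<le> t" "t < r" "t \<le> n" for t
    using that not_less_Least[of t Q] assms(1) by (cases "t = m") (auto simp: r_def Q_def)
  then have "e \<le> v t" if "m \<le> t" "t < r" "t \<le> n" for t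
    using that by (auto simp: e_def intro!: Min_le)
  moreover have "0 < e" "e \<le> c"
    using assms(2) by (auto simp: e_def)
  ultimately show thesis
    using r that by (auto simp: Q_def)
qed

text \<open>If \<open>E_init X\<close> were below \<open>E_min X\<close>, a battery could be forced
  to charge while load is shed. In the excluded lossless case with zero parameters, charging from
  shed load and discharging later can be cost neutral, so an optimal solution may do it.\<close>

theorem theorem2:
  fixes X :: "'b battery_data" and lam_c lam_d :: real and p :: "'b power"
  assumes "valid_data X"
    and "E_min X \<le> E_init X" and "E_init X \<le> E_max X"
    and "Ec_min X = 0" and "Ed_min X = 0"
    and "0 \<le> lam_c" and "0 \<le> lam_d"
    and "\<not> (lam_c = 0 \<and> lam_d = 0 \<and> eta_c X = 1 \<and> eta_d X = 1)"
    and "\<exists>\<theta> f u. reg_optimal X (lam_c, lam_d) (\<theta>, f, p, u)"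
  shows "(\<forall>t\<in>periods X. \<forall>i\<in>buses X. p_ch p t i * p_shed p t i = 0) \<and>
    (lam_c + eta_c X * eta_d X * lam_d > 1 - eta_c X * eta_d X \<longrightarrow>
      (\<forall>t\<in>periods X. \<forall>i\<in>buses X. p_dis p t i * p_exc p t i = 0))"
proof -
  obtain \<theta> f u where opt: "reg_optimal X (lam_c, lam_d) (\<theta>, f, p, u)"
    using assms(9) by blast
  have op: "operational X (\<theta>, f, p, u)" and bin:
    "\<And>t i. t \<in> periods X \<Longrightarrow> i \<in> buses X \<Longrightarrow> u t i \<in> {0, 1}"
    using opt by (auto simp: reg_optimal_def is_arg_min_def reg_feasible_def)
  \<comment> \<open>The round-trip efficiency.\<close>
  define k where "k = eta_c X * eta_d X"
  have eta: "0 < eta_c X" "0 < eta_d X" "eta_c X \<le> 1" "eta_d X \<le> 1"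
    using assms(1) by (auto simp: valid_data_def)
  have k: "0 < k" "k \<le> 1"
    using eta by (auto simp: k_def mult_le_one)
  have k1: "eta_c X = 1 \<and> eta_d X = 1" if "k = 1"
    using that eta mult_left_le[of "eta_d X" "eta_c X"] mult_right_le_one_le[of "eta_d X" "eta_c X"]
    by (auto simp: k_def)
  note optX = reg_optimal_exchange[OF assms(1,4,5) opt]
  have fin: "finite (periods X)"
    by (simp add: periods_def)
  have old: "0 \<le> p_ch p t i" "0 \<le> p_dis p t i"
      "p_soc p t i = p_soc p (t - 1) i + eta_c X * p_ch p t i - p_dis p t i / eta_d X"
      "E_min X \<le> p_soc p t i" "p_soc p t i \<le> E_max X"
      "p_ch p t i = 0 \<or> p_dis p t i = 0"
      "E_min X \<le> p_soc p (t - 1) i" "p_soc p (t - 1) i \<le> E_max X"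
      "0 \<le> p_shed p t i" "0 \<le> p_exc p t i"
    if t: "t \<in> periods X" and i: "i \<in> battery_buses X" for t i
  proof -
    have iB: "i \<in> buses X"
      using assms(1) i by (auto simp: valid_data_def)
    have *: "0 \<le> p_ch p t i \<and> p_ch p t i \<le> Ec_max X * u t i \<and>
        0 \<le> p_dis p t i \<and> p_dis p t i \<le> Ed_max X * (1 - u t i) \<and>
        p_soc p t i = p_soc p (t - 1) i + eta_c X * p_ch p t i - 1 / eta_d X * p_dis p t i \<and>
        p_soc p 0 i = E_init X \<and> E_min X \<le> p_soc p t i \<and> p_soc p t i \<le> E_max X"
      if "t \<in> periods X" for t
      using op that i assms(4,5) by (force simp: operational_def)
    show "p_ch p t i = 0 \<or> p_dis p t i = 0"
      using *[OF t] bin[OF t iB] by auto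
    \<comment> \<open>The limits bind only from period 1 on; for \<open>t = 1\<close> the preceding
      state is \<open>E_init X\<close>, covered by the assumptions on it.\<close>
    have "t = 1 \<or> t - 1 \<in> periods X"
      using t by (auto simp: periods_def)
    then show "E_min X \<le> p_soc p (t - 1) i" "p_soc p (t - 1) i \<le> E_max X"
      using *[OF t] *[of "t - 1"] assms(2,3) by auto
    show "0 \<le> p_shed p t i" "0 \<le> p_exc p t i"
      using op t iB by (auto simp: operational_def)
    show "0 \<le> p_ch p t i" "0 \<le> p_dis p t i"
      "p_soc p t i = p_soc p (t - 1) i + eta_c X * p_ch p t i - p_dis p t i / eta_d X"
      "E_min X \<le> p_soc p t i" "p_soc p t i \<le> E_max X"
      using *[OF t] by auto
  qed
  have nonbatt: "p_ch p t i = 0" "p_dis p t i = 0"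
    if "t \<in> periods X" "i \<in> buses X" "i \<notin> battery_buses X" for t i
    using op that by (auto simp: operational_def)
  have nonneg: "0 \<le> p_ch p t i" "0 \<le> p_dis p t i" "0 \<le> p_shed p t i" "0 \<le> p_exc p t i"
    if "t \<in> periods X" "i \<in> buses X" for t i
    using op that old(1,2)[of t i] nonbatt[of t i]
    by (cases "i \<in> battery_buses X"; force simp: operational_def)+
  have shed: "p_ch p m i * p_shed p m i = 0" if m: "m \<in> periods X" and iB: "i \<in> buses X" for m i
  proof (rule ccontr)
    assume "p_ch p m i * p_shed p m i \<noteq> 0"
    then have pos: "0 < p_ch p m i" "0 < p_shed p m i"
      using nonneg[OF m iB] by (auto simp: less_le)
    then have i: "i \<in> battery_buses X"
      using nonbatt[OF m iB] by auto
    note oldm = old[OF m i]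
    have "0 < eta_c X * p_ch p m i"
      using pos eta by simp
    \<comment> \<open>A charging battery does not discharge, so the state of charge has risen
      strictly from a value of at least \<open>E_min X\<close>.\<close>
    then have "E_min X < p_soc p m i"
      using oldm pos by auto
    \<comment> \<open>Division by \<open>eta_c X\<close> expresses the slack in units of charging
      power, the unit of \<open>e\<close>.\<close>
    then have "0 < (p_soc p m i - E_min X) / eta_c X"
      using eta by simp
    moreover have "0 < min (p_ch p m i) (p_shed p m i)"
      using pos by simp
    ultimately obtain r e where r: "m < r" and e: "0 < e" "e \<le> p_ch p m i" "e \<le> p_shed p m i"
      and slack: "\<And>t. m \<le> t \<Longrightarrow> t < r \<Longrightarrow> t \<le> horizon X \<Longrightarrow> e \<le> (p_soc p t i - E_min X) / eta_c X"
      and tight: "r \<le> horizon X \<Longrightarrow> (p_soc p r i - E_min X) / eta_c X \<le> 0"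
      using first_exhaustion[of "\<lambda>t. (p_soc p t i - E_min X) / eta_c X" m
          "min (p_ch p m i) (p_shed p m i)" "horizon X"]
      by (metis min.bounded_iff)
    \<comment> \<open>Between \<open>r - 1\<close>, which is at least \<open>m\<close>, and
      \<open>r\<close> the state of charge falls by at least \<open>eta_c X * e\<close>; charging
      cannot cause a fall, so discharging accounts for all of it.\<close>
    have dis_r: "k * e \<le> p_dis p r i" if "r \<in> periods X"
    proof -
      have "eta_c X * e \<le> p_soc p (r - 1) i - E_min X" "p_soc p r i \<le> E_min X"
        using slack[of "r - 1"] tight r m that eta by (auto simp: periods_def field_simps)
      moreover have "0 \<le> eta_c X * p_ch p r i"
        using old(1)[OF that i] eta by simp
      ultimately have "eta_c X * e \<le> p_dis p r i / eta_d X"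
        using old(3)[OF that i] by linarith
      then show ?thesis
        using eta by (simp add: k_def field_simps)
    qed
    \<comment> \<open>The amount \<open>k * e\<close> is chosen so that
      \<open>k * e / eta_d X = eta_c X * e\<close>, which brings \<open>w\<close> back to 0 at
      \<open>r\<close>. If \<open>r\<close> is past the horizon, the state simply stays lower to the
      end.\<close>
    define a where "a = (\<lambda>t. if t = m then e else 0)"
    define b where "b = (\<lambda>t. if t = r then k * e else 0)"
    define w where "w = (\<lambda>t. if m \<le> t \<and> t < r then eta_c X * e else 0)"
    have "(\<Sum>t\<in>periods X. (a t - b t) + 0 + lam_c * a t + lam_d * b t) \<le> 0"
    proof (rule optX[OF i, where w = w])
      fix t assume t: "t \<in> periods X"
      note oldt = old[OF t i]
      show "0 \<le> a t \<and> a t \<le> p_ch p t i"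
        using oldt e by (simp add: a_def)
      show "0 \<le> b t \<and> b t \<le> p_dis p t i"
        using oldt dis_r t e k by (auto simp: b_def)
      then show "a t - b t \<le> p_shed p t i"
        using oldt e by (auto simp: a_def)
      show "0 \<le> p_exc p t i"
        using oldt by simp
      show "w t = w (t - 1) + eta_c X * a t - b t / eta_d X"
        using r t m eta by (auto simp: w_def a_def b_def k_def periods_def)
      have "eta_c X * e \<ge> 0"
        using e eta by simp
      then show "E_min X \<le> p_soc p t i - w t \<and> p_soc p t i - w t \<le> E_max X"
        using oldt slack[of t] t eta by (auto simp: w_def periods_def field_simps)
    qed (use m in \<open>auto simp: w_def periods_def\<close>)
    then have "e * (1 + lam_c) - (if r \<in> periods X then k * e * (1 - lam_d) else 0) \<le> 0"
      using fin m by (simp add: sum.distrib sum_subtractf flip: sum_distrib_left)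
        (simp add: a_def b_def algebra_simps split: if_splits)
    \<comment> \<open>This excludes an \<open>r\<close> past the horizon, where the exchange would
      be a pure gain.\<close>
    moreover have "0 < e * (1 + lam_c)"
      using e assms(6) by simp
    ultimately have "e * (1 + lam_c) \<le> e * (k * (1 - lam_d))"
      by (auto simp: algebra_simps split: if_splits)
    then have "1 + lam_c \<le> k * (1 - lam_d)"
      using e by simp
    then have "1 + lam_c \<le> k - k * lam_d"
      by (simp add: right_diff_distrib)
    moreover have "0 \<le> k * lam_d"
      using k assms(7) by simp
    \<comment> \<open>The chain \<open>1 \<le> 1 + lam_c \<le> k - k * lam_d \<le> k \<le> 1\<close>
      collapses to equalities, which is the excluded case.\<close>
    ultimately have "lam_c = 0" "k = 1" "k * lam_d = 0"
      using k assms(6) by linarith+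
    then show False
      using k1 assms(8) by auto
  qed
  have exc: "p_dis p m i * p_exc p m i = 0"
    if gt: "lam_c + k * lam_d > 1 - k" and m: "m \<in> periods X" and iB: "i \<in> buses X" for m i
  proof (rule ccontr)
    assume "p_dis p m i * p_exc p m i \<noteq> 0"
    then have pos: "0 < p_dis p m i" "0 < p_exc p m i"
      using nonneg[OF m iB] by (auto simp: less_le)
    then have i: "i \<in> battery_buses X"
      using nonbatt[OF m iB] by auto
    note oldm = old[OF m i]
    have "0 < p_dis p m i / eta_d X"
      using pos eta by simp
    then have "p_soc p m i < E_max X"
      using oldm pos by auto
    \<comment> \<open>Discharging less by \<open>e\<close> raises the state of charge by
      \<open>e / eta_d X\<close>, hence the factor \<open>eta_d X\<close>.\<close>
    then have "0 < (E_max X - p_soc p m i) * eta_d X"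
      using eta by simp
    moreover have "0 < min (p_dis p m i) (p_exc p m i)"
      using pos by simp
    ultimately obtain r e where r: "m < r" and e: "0 < e" "e \<le> p_dis p m i" "e \<le> p_exc p m i"
      and slack: "\<And>t. m \<le> t \<Longrightarrow> t < r \<Longrightarrow> t \<le> horizon X \<Longrightarrow> e \<le> (E_max X - p_soc p t i) * eta_d X"
      and tight: "r \<le> horizon X \<Longrightarrow> (E_max X - p_soc p r i) * eta_d X \<le> 0"
      using first_exhaustion[of "\<lambda>t. (E_max X - p_soc p t i) * eta_d X" m
          "min (p_dis p m i) (p_exc p m i)" "horizon X"]
      by (metis min.bounded_iff)
    \<comment> \<open>The state of charge climbs by at least \<open>e / eta_d X\<close> into period
      \<open>r\<close>, and only charging, scaled by \<open>eta_c X\<close>, can raise it.\<close>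
    have ch_r: "e / k \<le> p_ch p r i" if "r \<in> periods X"
    proof -
      have "e / eta_d X \<le> E_max X - p_soc p (r - 1) i" "E_max X \<le> p_soc p r i"
        using slack[of "r - 1"] tight r m that eta
        by (auto simp: periods_def pos_divide_le_eq mult_le_0_iff)
      moreover have "0 \<le> p_dis p r i / eta_d X"
        using old(2)[OF that i] eta by simp
      ultimately have "e / eta_d X \<le> eta_c X * p_ch p r i"
        using old(3)[OF that i] by linarith
      then show ?thesis
        using eta by (simp add: k_def field_simps)
    qed
    define a where "a = (\<lambda>t. if t = r then e / k else 0)"
    define b where "b = (\<lambda>t. if t = m then e else 0)"
    \<comment> \<open>The sign is negative because the state of charge is now raised.\<close>
    define w where "w = (\<lambda>t. if m \<le> t \<and> t < r then - e / eta_d X else 0)"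
    have "(\<Sum>t\<in>periods X. 0 + (b t - a t) + lam_c * a t + lam_d * b t) \<le> 0"
    proof (rule optX[OF i, where w = w])
      fix t assume t: "t \<in> periods X"
      note oldt = old[OF t i]
      show "0 \<le> b t \<and> b t \<le> p_dis p t i"
        using oldt e by (simp add: b_def)
      show "0 \<le> a t \<and> a t \<le> p_ch p t i"
        using oldt ch_r t e k by (auto simp: a_def)
      then show "b t - a t \<le> p_exc p t i"
        using oldt e by (auto simp: b_def)
      show "0 \<le> p_shed p t i"
        using oldt by simp
      show "w t = w (t - 1) + eta_c X * a t - b t / eta_d X"
        using r t m eta by (auto simp: w_def a_def b_def k_def periods_def)
      have "0 \<le> e / eta_d X"
        using e eta by simp
      moreover have "e / eta_d X \<le> E_max X - p_soc p t i" if "m \<le> t" "t < r"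
        using slack[of t] that t eta by (auto simp: periods_def pos_divide_le_eq)
      ultimately show "E_min X \<le> p_soc p t i - w t \<and> p_soc p t i - w t \<le> E_max X"
        using oldt by (auto simp: w_def)
    qed (use m in \<open>auto simp: w_def periods_def\<close>)
    then have "e * (1 + lam_d) - (if r \<in> periods X then e / k * (1 - lam_c) else 0) \<le> 0"
      using fin m by (simp add: sum.distrib sum_subtractf flip: sum_distrib_left)
        (simp add: a_def b_def algebra_simps diff_divide_distrib split: if_splits)
    moreover have "0 < e * (1 + lam_d)"
      using e assms(7) by simp
    ultimately have "e * (1 + lam_d) \<le> e * ((1 - lam_c) / k)"
      by (auto split: if_splits)
    \<comment> \<open>Multiplied by \<open>k\<close>, this is the exact negation of
      \<open>gt\<close>.\<close>
    then have "1 + lam_d \<le> (1 - lam_c) / k"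
      using e(1) by (simp only: mult_le_cancel_left_pos)
    then show False
      using gt k by (simp add: field_simps)
  qed
  show ?thesis
    using shed exc by (auto simp: k_def)
qed

end
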